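(* The following three Wilf-equivalences hold: for every positive integer $n$, $$|\mathbf{I}_n(011,201)|=|\mathbf{I}_n(011,210)|,\quad |\mathbf{I}_n(000,201)|=|\mathbf{I}_n(000,210)|,\quad |\mathbf{I}_n(100,021)|=|\mathbf{I}_n(110,021)|.$$
   Context: An inversion sequence of length $n$ is an integer sequence $e=(e_1,\dots,e_n)$ with $0\le e_i\le i-1$ for all $1\le i\le n$. A word $w_1\cdots w_n$ avoids a pattern $P=p_1\cdots p_k$ if there are no $i_1<\cdots<i_k$ such that $w_{i_1}\cdots w_{i_k}$ is order isomorphic to $P$ (equal letters of $P$ corresponding to equal entries). $\mathbf{I}_n(P_1,\dots,P_r)$ denotes the set of inversion sequences of length $n$ avoiding all of the patterns $P_1,\dots,P_r$. Two sets of patterns $\Pi,\Pi'$ are Wilf-equivalent (on inversion sequences) if $|\mathbf{I}_n(\Pi)|=|\mathbf{I}_n(\Pi')|$ for every positive integer $n$. *)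

theory Defs
  imports Main "HOL-Library.Sublist"
begin

(* With 0-based indexing, the condition 0 <= e_i <= i - 1 (1 <= i <= n) reads e ! i <= i (i < n). *)
definition inversion_sequence :: "nat list \<Rightarrow> bool" where
  "inversion_sequence e \<longleftrightarrow> (\<forall>i<length e. e ! i \<le> i)"

definition order_isomorphic :: "nat list \<Rightarrow> nat list \<Rightarrow> bool" where
  "order_isomorphic u v \<longleftrightarrow>
     length u = length v \<and>
     (\<forall>i<length u. \<forall>j<length u.
        (u ! i < u ! j \<longleftrightarrow> v ! i < v ! j) \<and> (u ! i = u ! j \<longleftrightarrow> v ! i = v ! j))"

(* Subsequences of w need not be contiguous: subseq is the scattered-subsequence order. *)
definition avoids :: "nat list \<Rightarrow> nat list \<Rightarrow> bool" where
  "avoids w p \<longleftrightarrow> \<not> (\<exists>u. subseq u w \<and> order_isomorphic u p)"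

definition inv_seqs_avoiding :: "nat \<Rightarrow> nat list set \<Rightarrow> nat list set" where
  "inv_seqs_avoiding n Q =
     {e. length e = n \<and> inversion_sequence e \<and> (\<forall>p\<in>Q. avoids e p)}"

(* In particular, the cardinality of this set is never the default value 0 of an infinite set. *)
lemma finite_inv_seqs_avoiding: "finite (inv_seqs_avoiding n Q)"
proof (rule finite_subset)
  show "inv_seqs_avoiding n Q \<subseteq> {xs. set xs \<subseteq> {..n} \<and> length xs = n}"
    by (force simp: inv_seqs_avoiding_def inversion_sequence_def in_set_conv_nth)
  show "finite {xs. set xs \<subseteq> {..n} \<and> length xs = n}"
    by (rule finite_lists_length_eq) simp
qed

definition wilf_equivalent :: "nat list set \<Rightarrow> nat list set \<Rightarrow> bool" where
  "wilf_equivalent Q R \<longleftrightarrow>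
     (\<forall>n\<ge>1. card (inv_seqs_avoiding n Q) = card (inv_seqs_avoiding n R))"

end

theory Submission
  imports Defs "HOL-Library.Multiset"
begin

text \<open>
  \<^bold>\<open>201 against 210.\<close> Call an entry of a word a record if no earlier entry exceeds it. The larger
  entry in front that both patterns ask for says that the other two letters are non-records and
  stay non-records when they trade places. Fix the records, their positions and the multiset of all
  entries. Then the non-records can be arranged to avoid 210 in exactly one way, namely in weakly
  increasing order, and to avoid 201 in exactly one way, namely greedily, each place taking the
  largest unused value below the current maximum. Existence follows by taking an arrangement of
  extremal weight (\<open>ex_201_avoiding_rearrangement\<close>, \<open>ex_210_avoiding_rearrangement\<close>), uniqueness by
  looking at the first place where two arrangements differ (\<open>record_rearrangement_disagree\<close>). The
  resulting matching of 201-avoiders with 210-avoiders preserves the multiset of entries, and on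
  inversion sequences this multiset decides whether 000 and 011 are avoided: for 000 clearly, and for
  011 because the initial 0 makes a pattern with any positive value that is repeated.

  \<^bold>\<open>100 against 110, in the presence of 021.\<close> As an inversion sequence starts with 0, avoiding 021 means
  that its positive entries increase weakly. Split the sequence at its last zero into \<open>p\<close>, \<open>0\<close>, \<open>s\<close>.
  Avoiding 100 then forbids zeros of \<open>p\<close> behind a positive entry, so that \<open>p\<close> increases weakly, and
  avoiding 110 forbids repeated positive values in \<open>p\<close>, so that the positive entries of \<open>p\<close> increase
  strictly, with zeros in between (\<open>avoids_100_021_iff\<close>, \<open>avoids_110_021_iff\<close>). The two kinds of words
  correspond by exchanging a repetition of the preceding entry for a zero
  (\<open>card_last_zero_splits_le_less\<close>); neither the relation of \<open>p\<close> to \<open>s\<close> nor the bounds on the entries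
  are affected.
\<close>

section \<open>Patterns of length three\<close>

lemma subseq_Cons_iff_nth:
  "subseq (x # u) w \<longleftrightarrow> (\<exists>i<length w. w ! i = x \<and> subseq u (drop (Suc i) w))"
proof (induction w)
  case (Cons y w)
  have "(\<exists>i<length (y # w). (y # w) ! i = x \<and> subseq u (drop (Suc i) (y # w))) \<longleftrightarrow>
      y = x \<and> subseq u w \<or> (\<exists>i<length w. w ! i = x \<and> subseq u (drop (Suc i) w))"
    by (simp add: Ex_less_Suc2)
  moreover have "subseq (x # u) (y # w) \<longleftrightarrow> y = x \<and> subseq u w \<or> subseq (x # u) w"
    by (auto simp: subseq_Cons2_iff intro: subseq_Cons')
  ultimately show ?case
    using Cons.IH by simp
qed simp

lemma subseq3_iff_nth:
  "subseq [x, y, z] w \<longleftrightarrow>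
     (\<exists>i j k. i < j \<and> j < k \<and> k < length w \<and> w ! i = x \<and> w ! j = y \<and> w ! k = z)"
proof
  assume "subseq [x, y, z] w"
  then obtain i where i: "i < length w" "w ! i = x" "subseq [y, z] (drop (Suc i) w)"
    unfolding subseq_Cons_iff_nth[of x] by blast
  then obtain j where j: "j < length w - Suc i" "w ! (Suc i + j) = y"
    "subseq [z] (drop (Suc j) (drop (Suc i) w))"
    unfolding subseq_Cons_iff_nth[of y] by auto
  then obtain k where k: "k < length w - Suc i - Suc j" "w ! (Suc i + (Suc j + k)) = z"
    unfolding subseq_Cons_iff_nth[of z] by (auto simp: ac_simps)
  have "i < Suc i + j" "Suc i + j < Suc i + (Suc j + k)" "Suc i + (Suc j + k) < length w"
    using i j k by auto
  then show "\<exists>i j k. i < j \<and> j < k \<and> k < length w \<and> w ! i = x \<and> w ! j = y \<and> w ! k = z"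
    using i(2) j(2) k(2) by blast
next
  assume "\<exists>i j k. i < j \<and> j < k \<and> k < length w \<and> w ! i = x \<and> w ! j = y \<and> w ! k = z"
  then obtain i j k where ijk: "i < j" "j < k" "k < length w"
    and w: "w ! i = x" "w ! j = y" "w ! k = z" by blast
  have "subseq [z] (drop (Suc j) w)"
    unfolding subseq_Cons_iff_nth using ijk w by (intro exI[of _ "k - Suc j"]) simp
  then have "subseq [y, z] (drop (Suc i) w)"
    unfolding subseq_Cons_iff_nth[of y] using ijk w by (intro exI[of _ "j - Suc i"]) simp
  then show "subseq [x, y, z] w"
    unfolding subseq_Cons_iff_nth[of x] using ijk w by (intro exI[of _ i]) simp
qed

lemma avoids3_iff_nth:
  "avoids w [a, b, c] \<longleftrightarrow>
     (\<forall>i j k. i < j \<and> j < k \<and> k < length w \<longrightarrow>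
        \<not> order_isomorphic [w ! i, w ! j, w ! k] [a, b, c])"
proof -
  have "(\<exists>u. subseq u w \<and> order_isomorphic u [a, b, c]) \<longleftrightarrow>
      (\<exists>x y z. subseq [x, y, z] w \<and> order_isomorphic [x, y, z] [a, b, c])"
  proof
    assume "\<exists>u. subseq u w \<and> order_isomorphic u [a, b, c]"
    then obtain u where u: "subseq u w" "order_isomorphic u [a, b, c]" by blast
    then have "length u = Suc (Suc (Suc 0))"
      by (simp add: order_isomorphic_def)
    then obtain x y z where "u = [x, y, z]"
      by (auto simp: length_Suc_conv)
    with u show "\<exists>x y z. subseq [x, y, z] w \<and> order_isomorphic [x, y, z] [a, b, c]" by blast
  qed blast
  then show ?thesis
    unfolding avoids_def subseq3_iff_nth by blast
qed

lemma order_isomorphic3_iff: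
  "order_isomorphic [x, y, z] [a, b, c] \<longleftrightarrow>
     (x < y \<longleftrightarrow> a < b) \<and> (x = y \<longleftrightarrow> a = b) \<and>
     (x < z \<longleftrightarrow> a < c) \<and> (x = z \<longleftrightarrow> a = c) \<and>
     (y < z \<longleftrightarrow> b < c) \<and> (y = z \<longleftrightarrow> b = c)"
proof -
  \<comment> \<open>The nine comparisons reduce to three, since each pair is compared in both directions.\<close>
  define same where "same x y a b \<longleftrightarrow> (x < y \<longleftrightarrow> a < b) \<and> (x = y \<longleftrightarrow> a = b)" for x y a b :: nat
  have converse: "same y x b a" if "same x y a b" for x y a b
    using that by (auto simp: same_def)
  have "order_isomorphic [x, y, z] [a, b, c] \<longleftrightarrow>
      same x x a a \<and> same x y a b \<and> same x z a c \<and>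
      same y x b a \<and> same y y b b \<and> same y z b c \<and>
      same z x c a \<and> same z y c b \<and> same z z c c"
    unfolding order_isomorphic_def same_def[symmetric] by (simp add: All_less_Suc conj_ac)
  also have "\<dots> \<longleftrightarrow> same x y a b \<and> same x z a c \<and> same y z b c"
    using converse by (auto simp: same_def[of x x] same_def[of y y] same_def[of z z])
  finally show ?thesis
    unfolding same_def by simp
qed

lemma order_isomorphic_201_iff: "order_isomorphic [x, y, z] [2, 0, 1] \<longleftrightarrow> y < z \<and> z < x"
  unfolding order_isomorphic3_iff by auto

lemma order_isomorphic_210_iff: "order_isomorphic [x, y, z] [2, 1, 0] \<longleftrightarrow> z < y \<and> y < x"
  unfolding order_isomorphic3_iff by auto

lemma avoids_201_iff:
  "avoids w [2, 0, 1] \<longleftrightarrow>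
     (\<forall>i j k. i < j \<and> j < k \<and> k < length w \<longrightarrow> \<not> (w ! j < w ! k \<and> w ! k < w ! i))"
  unfolding avoids3_iff_nth order_isomorphic_201_iff by (rule refl)

lemma avoids_210_iff:
  "avoids w [2, 1, 0] \<longleftrightarrow>
     (\<forall>i j k. i < j \<and> j < k \<and> k < length w \<longrightarrow> \<not> (w ! k < w ! j \<and> w ! j < w ! i))"
  unfolding avoids3_iff_nth order_isomorphic_210_iff by (rule refl)

section \<open>Rearranging the entries that are not records\<close>

definition non_record :: "nat list \<Rightarrow> nat \<Rightarrow> bool" where
  "non_record w j \<longleftrightarrow> (\<exists>i<j. w ! j < w ! i)"

definition record_rearrangement :: "nat list \<Rightarrow> nat list \<Rightarrow> bool" where
  "record_rearrangement u v \<longleftrightarrow> mset u = mset v \<and>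
     (\<forall>j<length u. (non_record u j \<longleftrightarrow> non_record v j) \<and> (\<not> non_record u j \<longrightarrow> u ! j = v ! j))"

lemma record_rearrangement_length: "record_rearrangement u v \<Longrightarrow> length u = length v"
  by (metis record_rearrangement_def size_mset)

lemma record_rearrangement_refl: "record_rearrangement u u"
  by (simp add: record_rearrangement_def)

lemma record_rearrangement_sym: "record_rearrangement u v \<Longrightarrow> record_rearrangement v u"
  using record_rearrangement_length[of u v] by (auto simp: record_rearrangement_def)

lemma record_rearrangement_trans:
  "record_rearrangement u v \<Longrightarrow> record_rearrangement v w \<Longrightarrow> record_rearrangement u w"
  using record_rearrangement_length[of u v] by (auto simp: record_rearrangement_def)

text \<open>
  The records keep their values, and a non-record lies below an earlier entry, whose bound is
  already smaller than its own.
\<close>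

lemma inversion_sequence_record_rearrangement:
  assumes "record_rearrangement u v" "inversion_sequence u"
  shows "inversion_sequence v"
  unfolding inversion_sequence_def
proof (intro allI impI)
  fix j assume "j < length v"
  then show "v ! j \<le> j"
  proof (induction j rule: less_induct)
    case (less j)
    have len: "length u = length v"
      using assms(1) by (rule record_rearrangement_length)
    show ?case
    proof (cases "non_record v j")
      case True
      then obtain i where "i < j" "v ! j < v ! i"
        by (auto simp: non_record_def)
      with less show ?thesis by fastforce
    next
      case False
      with assms less.prems len have "v ! j = u ! j"
        by (auto simp: record_rearrangement_def)
      with assms(2) less.prems len show ?thesis
        by (simp add: inversion_sequence_def)
    qed
  qed
qed

text \<open>
  A word that contains 201 or 210 can thus be improved by a swap without leaving its class.
\<close>

lemma record_rearrangement_swap: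
  assumes "i < j" "j < k" "k < length w" "w ! j < w ! i" "w ! k < w ! i"
  shows "record_rearrangement w (w[j := w ! k, k := w ! j])"
proof -
  let ?v = "w[j := w ! k, k := w ! j]"
  have v: "?v ! p = (if p = j then w ! k else if p = k then w ! j else w ! p)" for p
    using assms by (cases "p < length w") (auto simp: nth_list_update)
  have "mset w = mset ?v"
    using assms mset_swap[of k w j] by simp
  moreover have "non_record w p \<longleftrightarrow> non_record ?v p" for p
  proof (cases "p = j \<or> p = k")
    case True
    with assms have "non_record w p" "non_record ?v p"
      unfolding non_record_def v by (auto intro!: exI[of _ i])
    then show ?thesis by simp
  next
    case False
    show ?thesis
    proof
      assume "non_record w p"
      then obtain q where "q < p" "w ! p < w ! q"
        by (auto simp: non_record_def)
      \<comment> \<open>If the larger entry moves, the entry at \<open>i\<close> is larger still and stays where it is.\<close>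
      then have "(if q = j \<or> q = k then i else q) < p"
        "?v ! p < ?v ! (if q = j \<or> q = k then i else q)"
        unfolding v using assms False by auto
      then show "non_record ?v p"
        unfolding non_record_def by blast
    next
      assume "non_record ?v p"
      then obtain q where "q < p" "?v ! p < ?v ! q"
        by (auto simp: non_record_def)
      then have "(if q = j \<or> q = k then i else q) < p"
        "w ! p < w ! (if q = j \<or> q = k then i else q)"
        unfolding v using assms False by (auto split: if_splits)
      then show "non_record w p"
        unfolding non_record_def by blast
    qed
  qed
  moreover have "w ! p = ?v ! p" if "\<not> non_record w p" for p
  proof -
    have "non_record w j" "non_record w k"
      using assms unfolding non_record_def by (auto intro!: exI[of _ i])
    with that have "p \<noteq> j" "p \<noteq> k" by auto
    then show ?thesis by (simp add: v)
  qed
  ultimately show ?thesis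
    unfolding record_rearrangement_def by blast
qed

text \<open>
  This sum is largest when large entries stand far to the right, so a swap that removes an inversion
  raises it and a swap that creates one lowers it.
\<close>

definition weight :: "nat list \<Rightarrow> nat" where
  "weight w = (\<Sum>i<length w. i * w ! i)"

lemma weight_swap_less:
  assumes "j < k" "k < length w" "w ! j < w ! k"
  shows "weight (w[j := w ! k, k := w ! j]) < weight w"
proof -
  let ?v = "w[j := w ! k, k := w ! j]"
  let ?R = "{..<length w} - {k} - {j}"
  have split: "(\<Sum>i<length w. f i) = f k + (f j + sum f ?R)" for f :: "nat \<Rightarrow> nat"
    using assms by (subst sum.remove[of _ k]; simp) (subst sum.remove[of _ j]; simp)
  have rest: "(\<Sum>i\<in>?R. i * ?v ! i) = (\<Sum>i\<in>?R. i * w ! i)"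
    by (rule sum.cong) (auto simp: nth_list_update)
  obtain d e where "k = j + Suc d" "w ! k = w ! j + Suc e"
    using assms less_imp_Suc_add by (metis add_Suc_right)
  then have "k * w ! j + j * w ! k < k * w ! k + j * w ! j"
    by (simp add: algebra_simps)
  then show ?thesis
    unfolding weight_def using assms split[of "\<lambda>i. i * ?v ! i"] split[of "\<lambda>i. i * w ! i"] rest
    by (simp add: nth_list_update)
qed

lemma weight_swap_greater:
  assumes "j < k" "k < length w" "w ! k < w ! j"
  shows "weight w < weight (w[j := w ! k, k := w ! j])"
proof -
  let ?v = "w[j := w ! k, k := w ! j]"
  have "?v[j := ?v ! k, k := ?v ! j] = w"
    using assms by (intro nth_equalityI) (auto simp: nth_list_update)
  then show ?thesis
    using weight_swap_less[of j k ?v] assms by (simp add: nth_list_update)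
qed

text \<open>
  In an occurrence of 201, swapping the last two letters lowers the weight; hence a rearrangement of
  least weight has no such occurrence.
\<close>

lemma ex_201_avoiding_rearrangement:
  "\<exists>v. record_rearrangement w v \<and> avoids v [2, 0, 1]"
proof -
  obtain v where v: "record_rearrangement w v"
    and min: "\<And>u. record_rearrangement w u \<Longrightarrow> weight v \<le> weight u"
    using ex_has_least_nat[of "record_rearrangement w" w weight] record_rearrangement_refl
    by blast
  have "avoids v [2, 0, 1]"
    unfolding avoids_201_iff
  proof (intro allI impI notI)
    fix i j k assume "i < j \<and> j < k \<and> k < length v" "v ! j < v ! k \<and> v ! k < v ! i"
    then show False
      using record_rearrangement_swap[of i j k v] weight_swap_less[of j k v]
        record_rearrangement_trans[OF v] min
      by (meson leD less_trans)
  qed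
  with v show ?thesis by blast
qed

text \<open>
  Dually, swapping the last two letters of an occurrence of 210 raises the weight, which is bounded
  because a word has only finitely many rearrangements.
\<close>

lemma ex_210_avoiding_rearrangement:
  "\<exists>v. record_rearrangement w v \<and> avoids v [2, 1, 0]"
proof -
  have "finite {u. record_rearrangement w u}"
    by (rule finite_subset[OF _ mset_eq_finite[of w]]) (auto simp: record_rearrangement_def)
  then have "finite (weight ` {u. record_rearrangement w u})"
    by simp
  then have "\<forall>u. record_rearrangement w u \<longrightarrow> weight u \<le> Max (weight ` {u. record_rearrangement w u})"
    by auto
  then obtain v where v: "record_rearrangement w v"
    and max: "\<And>u. record_rearrangement w u \<Longrightarrow> weight u \<le> weight v"
    using ex_has_greatest_nat[of "record_rearrangement w" w weight] record_rearrangement_refl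
    by (metis le_imp_less_Suc)
  have "avoids v [2, 1, 0]"
    unfolding avoids_210_iff
  proof (intro allI impI notI)
    fix i j k assume "i < j \<and> j < k \<and> k < length v" "v ! k < v ! j \<and> v ! j < v ! i"
    then show False
      using record_rearrangement_swap[of i j k v] weight_swap_greater[of j k v]
        record_rearrangement_trans[OF v] max
      by (meson leD less_trans)
  qed
  with v show ?thesis by blast
qed

lemma mset_eq_first_difference:
  assumes "mset u = mset v" "u \<noteq> v"
  obtains j where "j < length u" "take j u = take j v" "u ! j \<noteq> v ! j"
    "v ! j \<in> set (drop (Suc j) u)" "u ! j \<in> set (drop (Suc j) v)"
proof -
  have len: "length u = length v"
    using assms(1) by (metis size_mset)
  define j where "j = (LEAST j. j < length u \<and> u ! j \<noteq> v ! j)"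
  have "\<exists>j. j < length u \<and> u ! j \<noteq> v ! j"
    using assms(2) len by (meson nth_equalityI)
  then have j: "j < length u" "u ! j \<noteq> v ! j"
    unfolding j_def by (metis (mono_tags, lifting) LeastI_ex)+
  have "u ! i = v ! i" if "i < j" for i
    using not_less_Least[of i "\<lambda>j. j < length u \<and> u ! j \<noteq> v ! j"] that j(1)
    unfolding j_def by auto
  then have pre: "take j u = take j v"
    using j len by (intro nth_equalityI) auto
  have "mset (take j u) + mset (u ! j # drop (Suc j) u) = mset (take j v) + mset (v ! j # drop (Suc j) v)"
    using assms(1) j(1) len by (metis id_take_nth_drop mset_append)
  then have eq: "mset (u ! j # drop (Suc j) u) = mset (v ! j # drop (Suc j) v)"
    using pre by simp
  then have "set (u ! j # drop (Suc j) u) = set (v ! j # drop (Suc j) v)"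
    by (rule mset_eq_setD)
  then show thesis
    using that[OF j(1) pre j(2)] j(2) by (metis insert_iff list.simps(15))
qed

lemma in_set_drop_Suc:
  assumes "x \<in> set (drop (Suc j) w)"
  obtains k where "j < k" "k < length w" "w ! k = x"
proof -
  obtain d where "d < length (drop (Suc j) w)" "drop (Suc j) w ! d = x"
    using assms by (metis in_set_conv_nth)
  then show thesis
    by (intro that[of "Suc j + d"]) simp_all
qed

text \<open>
  At the first disagreement \<open>j\<close>, both words have a non-record, and each needs the other's entry later
  on. Together with an earlier larger entry \<open>i\<close> this puts an occurrence of 210 into the word with
  the larger entry at \<open>j\<close> and an occurrence of 201 into the other word.
\<close>

lemma record_rearrangement_disagree:
  assumes "record_rearrangement u v" "u \<noteq> v"
  obtains i j k k' where "i < j" "j < k" "k < length u" "j < k'" "k' < length v" "u ! i = v ! i"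
    "u ! j < u ! i" "v ! j < v ! i" "u ! j \<noteq> v ! j" "u ! k = v ! j" "v ! k' = u ! j"
proof -
  have ms: "mset u = mset v" and len: "length u = length v"
    using assms(1) record_rearrangement_length by (auto simp: record_rearrangement_def)
  obtain j where j: "j < length u" "take j u = take j v" "u ! j \<noteq> v ! j"
    "v ! j \<in> set (drop (Suc j) u)" "u ! j \<in> set (drop (Suc j) v)"
    using mset_eq_first_difference[OF ms assms(2)] .
  have pre: "u ! i = v ! i" if "i < j" for i
    using arg_cong[OF j(2), of "\<lambda>x. x ! i"] that by simp
  obtain k where k: "j < k" "k < length u" "u ! k = v ! j"
    using j(4) by (rule in_set_drop_Suc)
  obtain k' where k': "j < k'" "k' < length v" "v ! k' = u ! j"
    using j(5) by (rule in_set_drop_Suc)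
  have nr: "non_record u j" "non_record v j"
    using assms(1) j(1,3) unfolding record_rearrangement_def by blast+
  obtain a b where a: "a < j" "u ! j < u ! a" and b: "b < j" "v ! j < v ! b"
    using nr by (auto simp: non_record_def)
  \<comment> \<open>The two words agree before \<open>j\<close>, so the larger of the two witnesses serves for both.\<close>
  define i where "i = (if u ! a \<le> u ! b then b else a)"
  have i: "i < j" "u ! j < u ! i" "v ! j < v ! i"
    using a b pre[of a] pre[of b] unfolding i_def by (simp_all split: if_split)
  show thesis
    by (rule that[OF i(1) k(1,2) k'(1,2) pre[OF i(1)] i(2,3) j(3) k(3) k'(3)])
qed

lemma unique_201_avoiding_rearrangement:
  assumes uv: "record_rearrangement u v" and av: "avoids u [2, 0, 1]" "avoids v [2, 0, 1]"
  shows "u = v"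
proof (rule ccontr)
  assume "u \<noteq> v"
  with uv obtain i j k k' where "i < j" "j < k" "k < length u" "j < k'" "k' < length v"
    "u ! i = v ! i" "u ! j < u ! i" "v ! j < v ! i" "u ! j \<noteq> v ! j" "u ! k = v ! j" "v ! k' = u ! j"
    by (rule record_rearrangement_disagree)
  then show False
    using av unfolding avoids_201_iff by (metis linorder_neqE_nat)
qed

lemma unique_210_avoiding_rearrangement:
  assumes uv: "record_rearrangement u v" and av: "avoids u [2, 1, 0]" "avoids v [2, 1, 0]"
  shows "u = v"
proof (rule ccontr)
  assume "u \<noteq> v"
  with uv obtain i j k k' where "i < j" "j < k" "k < length u" "j < k'" "k' < length v"
    "u ! i = v ! i" "u ! j < u ! i" "v ! j < v ! i" "u ! j \<noteq> v ! j" "u ! k = v ! j" "v ! k' = u ! j"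
    by (rule record_rearrangement_disagree)
  then show False
    using av unfolding avoids_210_iff by (metis linorder_neqE_nat)
qed

text \<open>
  The case in mind is that \<open>A\<close> and \<open>B\<close> are two systems of unique representatives of the same
  classes: the bijection sends each element to the representative of its class.
\<close>

lemma card_eq_if_unique_partners:
  assumes "\<And>a. a \<in> A \<Longrightarrow> \<exists>!b. b \<in> B \<and> R a b" "\<And>b. b \<in> B \<Longrightarrow> \<exists>!a. a \<in> A \<and> R a b"
  shows "card A = card B"
proof -
  define f where "f a = (THE b. b \<in> B \<and> R a b)" for a
  have f: "f a \<in> B \<and> R a (f a)" if "a \<in> A" for a
    unfolding f_def using theI'[OF assms(1)[OF that]] .
  have "bij_betw f A B"
    unfolding bij_betw_def
  proof
    show "inj_on f A"
      by (rule inj_onI) (metis f assms(2))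
    show "f ` A = B"
    proof
      show "B \<subseteq> f ` A"
      proof
        fix b assume "b \<in> B"
        then obtain a where "a \<in> A" "R a b" using assms(2) by blast
        with f[of a] assms(1)[of a] \<open>b \<in> B\<close> show "b \<in> f ` A" by blast
      qed
    qed (use f in blast)
  qed
  then show ?thesis by (rule bij_betw_same_card)
qed

text \<open>
  Each class of rearrangements of an inversion sequence contains one 201-avoider and one
  210-avoider, and a third pattern that depends only on the multiset of entries accepts or rejects
  whole classes.
\<close>

lemma wilf_equivalent_201_210:
  assumes inv: "\<And>u v. \<lbrakk>inversion_sequence u; inversion_sequence v; mset u = mset v; avoids u p\<rbrakk>
    \<Longrightarrow> avoids v p"
  shows "wilf_equivalent {p, [2, 0, 1]} {p, [2, 1, 0]}"
  unfolding wilf_equivalent_def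
proof (intro allI impI)
  fix n :: nat
  let ?A = "inv_seqs_avoiding n {p, [2, 0, 1]}" and ?B = "inv_seqs_avoiding n {p, [2, 1, 0]}"
  have transfer: "length v = n \<and> inversion_sequence v \<and> avoids v p"
    if "record_rearrangement u v" "length u = n" "inversion_sequence u" "avoids u p" for u v
    using that inversion_sequence_record_rearrangement[OF that(1,3)]
      record_rearrangement_length[OF that(1)] inv[of u v]
    by (auto simp: record_rearrangement_def)
  show "card ?A = card ?B"
  proof (rule card_eq_if_unique_partners[where R = record_rearrangement])
    fix a assume a: "a \<in> ?A"
    obtain v where v: "record_rearrangement a v" "avoids v [2, 1, 0]"
      using ex_210_avoiding_rearrangement by blast
    show "\<exists>!b. b \<in> ?B \<and> record_rearrangement a b"
    proof (rule ex1I[of _ v])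
      show "v \<in> ?B \<and> record_rearrangement a v"
        using transfer[OF v(1)] a v by (auto simp: inv_seqs_avoiding_def)
      fix b assume b: "b \<in> ?B \<and> record_rearrangement a b"
      then have "record_rearrangement b v"
        using v(1) record_rearrangement_sym record_rearrangement_trans by blast
      then show "b = v"
        using b v(2) by (auto simp: inv_seqs_avoiding_def intro: unique_210_avoiding_rearrangement)
    qed
  next
    fix b assume b: "b \<in> ?B"
    obtain v where v: "record_rearrangement b v" "avoids v [2, 0, 1]"
      using ex_201_avoiding_rearrangement by blast
    show "\<exists>!a. a \<in> ?A \<and> record_rearrangement a b"
    proof (rule ex1I[of _ v])
      show "v \<in> ?A \<and> record_rearrangement v b"
        using transfer[OF v(1)] b v record_rearrangement_sym by (auto simp: inv_seqs_avoiding_def)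
      fix a assume a: "a \<in> ?A \<and> record_rearrangement a b"
      then have "record_rearrangement a v"
        using v(1) record_rearrangement_trans by blast
      then show "a = v"
        using a v(2) by (auto simp: inv_seqs_avoiding_def intro: unique_201_avoiding_rearrangement)
    qed
  qed
qed

section \<open>Patterns that only see multiplicities\<close>

lemma replicate_subseq_iff_count: "subseq (replicate m x) w \<longleftrightarrow> m \<le> count (mset w) x"
proof (induction w arbitrary: m)
  case Nil
  then show ?case by (cases m) auto
next
  case (Cons y w)
  show ?case
  proof (cases m)
    case (Suc m')
    then show ?thesis
      using Cons.IH[of m'] Cons.IH[of m] by (auto simp: subseq_Cons2_iff)
  qed simp
qed

lemma avoids_000_iff_count: "avoids w [0, 0, 0] \<longleftrightarrow> (\<forall>x. count (mset w) x < 3)"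
proof -
  have all_equal: "order_isomorphic u [0, 0, 0] \<longleftrightarrow> (\<exists>x. u = [x, x, x])" for u
  proof
    assume oi: "order_isomorphic u [0, 0, 0]"
    then have "length u = Suc (Suc (Suc 0))"
      by (simp add: order_isomorphic_def)
    then obtain x y z where "u = [x, y, z]"
      by (auto simp: length_Suc_conv)
    with oi show "\<exists>x. u = [x, x, x]"
      by (simp add: order_isomorphic3_iff)
  qed (auto simp: order_isomorphic3_iff)
  have "avoids w [0, 0, 0] \<longleftrightarrow> (\<forall>x. \<not> subseq [x, x, x] w)"
    unfolding avoids_def all_equal by blast
  also have "\<dots> \<longleftrightarrow> (\<forall>x. \<not> subseq (replicate 3 x) w)"
    by (simp add: numeral_3_eq_3)
  finally have "avoids w [0, 0, 0] \<longleftrightarrow> (\<forall>x. \<not> subseq (replicate 3 x) w)" .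
  then show ?thesis
    by (simp add: replicate_subseq_iff_count not_le)
qed

lemma inversion_sequence_nth_0: "inversion_sequence w \<Longrightarrow> w \<noteq> [] \<Longrightarrow> w ! 0 = 0"
  by (auto simp: inversion_sequence_def)

text \<open>
  The entry 0 at the front precedes every repeated positive value, so the smaller first letter of
  the pattern is always available.
\<close>

lemma avoids_011_iff_count:
  assumes "inversion_sequence w"
  shows "avoids w [0, 1, 1] \<longleftrightarrow> (\<forall>x>0. count (mset w) x < 2)"
proof -
  have "avoids w [0, 1, 1] \<longleftrightarrow> (\<forall>x>0. \<not> subseq (replicate 2 x) w)"
  proof
    assume av: "avoids w [0, 1, 1]"
    show "\<forall>x>0. \<not> subseq (replicate 2 x) w"
    proof (intro allI impI notI)
      fix x :: nat assume "x > 0" "subseq (replicate 2 x) w"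
      moreover from this have "w \<noteq> []" by (auto simp: numeral_2_eq_2)
      then obtain w' where "w = 0 # w'"
        using inversion_sequence_nth_0[OF assms] by (cases w) auto
      ultimately have "subseq [0, x, x] w"
        by (simp add: numeral_2_eq_2)
      with \<open>x > 0\<close> av show False
        unfolding avoids_def by (force simp: order_isomorphic3_iff)
    qed
  next
    assume rep: "\<forall>x>0. \<not> subseq (replicate 2 x) w"
    show "avoids w [0, 1, 1]"
      unfolding avoids3_iff_nth
    proof (intro allI impI notI)
      fix i j k assume ijk: "i < j \<and> j < k \<and> k < length w"
        and "order_isomorphic [w ! i, w ! j, w ! k] [0, 1, 1]"
      then have "w ! i < w ! j" "w ! j = w ! k"
        by (auto simp: order_isomorphic3_iff)
      then have "subseq [w ! i, w ! j, w ! j] w"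
        using ijk unfolding subseq3_iff_nth by metis
      then have "subseq (replicate 2 (w ! j)) w"
        by (metis numeral_2_eq_2 replicate_0 replicate_Suc subseq_Cons')
      with rep \<open>w ! i < w ! j\<close> show False by auto
    qed
  qed
  then show ?thesis
    by (simp add: replicate_subseq_iff_count not_le)
qed

section \<open>Exchanging zeros and repetitions before the last zero\<close>

text \<open>
  For two entries \<open>x > y > 0\<close> in this order, the initial 0 completes the pattern.
\<close>

lemma avoids_021_iff:
  assumes "inversion_sequence w"
  shows "avoids w [0, 2, 1] \<longleftrightarrow> sorted_wrt (\<lambda>x y. x \<le> y \<or> y = 0) w"
proof
  assume av: "avoids w [0, 2, 1]"
  show "sorted_wrt (\<lambda>x y. x \<le> y \<or> y = 0) w"
    unfolding sorted_wrt_iff_nth_less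
  proof (intro allI impI, rule ccontr)
    fix j k assume jk: "j < k" "k < length w" and bad: "\<not> (w ! j \<le> w ! k \<or> w ! k = 0)"
    have "w ! 0 = 0"
      using jk by (intro inversion_sequence_nth_0[OF assms]) auto
    moreover from this bad have "0 < j" by (cases j) auto
    ultimately show False
      using av jk bad unfolding avoids3_iff_nth order_isomorphic3_iff by force
  qed
next
  assume nz: "sorted_wrt (\<lambda>x y. x \<le> y \<or> y = 0) w"
  show "avoids w [0, 2, 1]"
    unfolding avoids3_iff_nth
  proof (intro allI impI notI)
    fix i j k assume "i < j \<and> j < k \<and> k < length w"
      and "order_isomorphic [w ! i, w ! j, w ! k] [0, 2, 1]"
    then show False
      using sorted_wrt_nth_less[OF nz, of j k] by (auto simp: order_isomorphic3_iff)
  qed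
qed

lemma sorted_wrt_split_last_zero:
  fixes p s :: "nat list"
  assumes "0 \<notin> set s"
  shows "sorted_wrt (\<lambda>x y. x \<le> y \<or> y = 0) (p @ 0 # s) \<longleftrightarrow>
    sorted_wrt (\<lambda>x y. x \<le> y \<or> y = 0) p \<and> sorted s \<and> (\<forall>x\<in>set p. \<forall>y\<in>set s. x \<le> y)"
proof -
  have "sorted_wrt (\<lambda>x y. x \<le> y \<or> y = 0) s \<longleftrightarrow> sorted s"
    using assms by (intro iffI; elim sorted_wrt_mono_rel[rotated]) auto
  then show ?thesis
    using assms by (auto simp: sorted_wrt_append)
qed

lemma nth_last_zero:
  fixes p s :: "nat list"
  assumes "0 \<notin> set s" "k < length (p @ 0 # s)" "(p @ 0 # s) ! k = 0"
  shows "k \<le> length p"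
proof (rule ccontr)
  assume "\<not> k \<le> length p"
  then obtain d where "k = length p + Suc d"
    using less_imp_Suc_add by force
  then show False
    using assms nth_mem[of d s] by (auto simp: nth_append)
qed

text \<open>
  Given 021-avoidance, the two smaller letters of an occurrence of 100 must be zeros. The second one
  may be taken to be the last zero, so the other two letters lie in \<open>p\<close>.
\<close>

lemma avoids_100_021_iff:
  assumes inv: "inversion_sequence (p @ 0 # s)" and s: "0 \<notin> set s"
  shows "avoids (p @ 0 # s) [1, 0, 0] \<and> avoids (p @ 0 # s) [0, 2, 1] \<longleftrightarrow>
    sorted p \<and> sorted s \<and> (\<forall>x\<in>set p. \<forall>y\<in>set s. x \<le> y)"
proof -
  let ?e = "p @ 0 # s"
  have "avoids ?e [1, 0, 0] \<longleftrightarrow> sorted_wrt (\<lambda>x y. y = 0 \<longrightarrow> x = 0) p"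
    if nz: "sorted_wrt (\<lambda>x y. x \<le> y \<or> y = 0) ?e"
  proof
    assume av: "avoids ?e [1, 0, 0]"
    show "sorted_wrt (\<lambda>x y. y = 0 \<longrightarrow> x = 0) p"
      unfolding sorted_wrt_iff_nth_less
    proof (intro allI impI, rule ccontr)
      fix i j assume ij: "i < j" "j < length p" "p ! j = 0" "p ! i \<noteq> 0"
      then have "order_isomorphic [?e ! i, ?e ! j, ?e ! length p] [1, 0, 0]"
        by (simp add: order_isomorphic3_iff nth_append)
      with av ij show False
        unfolding avoids3_iff_nth by force
    qed
  next
    assume z: "sorted_wrt (\<lambda>x y. y = 0 \<longrightarrow> x = 0) p"
    show "avoids ?e [1, 0, 0]"
      unfolding avoids3_iff_nth
    proof (intro allI impI notI)
      fix i j k assume ijk: "i < j \<and> j < k \<and> k < length ?e"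
        and "order_isomorphic [?e ! i, ?e ! j, ?e ! k] [1, 0, 0]"
      then have e: "?e ! j < ?e ! i" "?e ! j = ?e ! k"
        by (auto simp: order_isomorphic3_iff)
      have "?e ! i \<le> ?e ! j \<or> ?e ! j = 0"
        using sorted_wrt_nth_less[OF nz, of i j] ijk by linarith
      with e have "?e ! j = 0" "?e ! k = 0" by auto
      with ijk s have "k \<le> length p"
        by (intro nth_last_zero[OF s, of k]) auto
      with ijk have "j < length p" by simp
      with ijk z \<open>?e ! j = 0\<close> have "?e ! i = 0"
        unfolding sorted_wrt_iff_nth_less by (auto simp: nth_append)
      with e show False by simp
    qed
  qed
  moreover have "sorted p \<longleftrightarrow>
      sorted_wrt (\<lambda>x y. x \<le> y \<or> y = 0) p \<and> sorted_wrt (\<lambda>x y. y = 0 \<longrightarrow> x = 0) p"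
    by (induction p) auto
  ultimately show ?thesis
    unfolding avoids_021_iff[OF inv] using sorted_wrt_split_last_zero[OF s, of p] by blast
qed

text \<open>
  Given 021-avoidance, the last letter of an occurrence of 110 must be a zero, and it may be taken to be
  the last zero. The two equal letters then lie in \<open>p\<close>.
\<close>

lemma avoids_110_021_iff:
  assumes inv: "inversion_sequence (p @ 0 # s)" and s: "0 \<notin> set s"
  shows "avoids (p @ 0 # s) [1, 1, 0] \<and> avoids (p @ 0 # s) [0, 2, 1] \<longleftrightarrow>
    sorted_wrt (\<lambda>x y. x < y \<or> y = 0) p \<and> sorted s \<and> (\<forall>x\<in>set p. \<forall>y\<in>set s. x \<le> y)"
proof -
  let ?e = "p @ 0 # s"
  have "avoids ?e [1, 1, 0] \<longleftrightarrow> sorted_wrt (\<lambda>x y. x = y \<longrightarrow> y = 0) p"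
    if nz: "sorted_wrt (\<lambda>x y. x \<le> y \<or> y = 0) ?e"
  proof
    assume av: "avoids ?e [1, 1, 0]"
    show "sorted_wrt (\<lambda>x y. x = y \<longrightarrow> y = 0) p"
      unfolding sorted_wrt_iff_nth_less
    proof (intro allI impI, rule ccontr)
      fix i j assume ij: "i < j" "j < length p" "p ! i = p ! j" "p ! j \<noteq> 0"
      then have "order_isomorphic [?e ! i, ?e ! j, ?e ! length p] [1, 1, 0]"
        by (simp add: order_isomorphic3_iff nth_append)
      with av ij show False
        unfolding avoids3_iff_nth by force
    qed
  next
    assume z: "sorted_wrt (\<lambda>x y. x = y \<longrightarrow> y = 0) p"
    show "avoids ?e [1, 1, 0]"
      unfolding avoids3_iff_nth
    proof (intro allI impI notI)
      fix i j k assume ijk: "i < j \<and> j < k \<and> k < length ?e"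
        and "order_isomorphic [?e ! i, ?e ! j, ?e ! k] [1, 1, 0]"
      then have e: "?e ! k < ?e ! j" "?e ! i = ?e ! j"
        by (auto simp: order_isomorphic3_iff)
      have "?e ! j \<le> ?e ! k \<or> ?e ! k = 0"
        using sorted_wrt_nth_less[OF nz, of j k] ijk by metis
      with e have "?e ! k = 0" by auto
      with ijk s have "k \<le> length p"
        by (intro nth_last_zero[OF s, of k]) auto
      with ijk have "j < length p" by simp
      with ijk e sorted_wrt_nth_less[OF z, of i j] have "?e ! j = 0"
        by (simp add: nth_append_left)
      with e show False by simp
    qed
  qed
  moreover have "sorted_wrt (\<lambda>x y. x < y \<or> y = 0) p \<longleftrightarrow>
      sorted_wrt (\<lambda>x y. x \<le> y \<or> y = 0) p \<and> sorted_wrt (\<lambda>x y. x = y \<longrightarrow> y = 0) p"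
    by (induction p) (auto simp: le_less)
  ultimately show ?thesis
    unfolding avoids_021_iff[OF inv] using sorted_wrt_split_last_zero[OF s, of p] by blast
qed

text \<open>
  The two directions of the exchange between repetitions and zeros. Both start from \<open>m = 0\<close>, so
  that initial zeros also count as repetitions and remain zeros in either direction. On words whose
  positive entries increase, the running maximum changes only the zeros.
\<close>

primrec running_max :: "nat \<Rightarrow> nat list \<Rightarrow> nat list" where
  "running_max m [] = []"
| "running_max m (x # xs) = max m x # running_max (max m x) xs"

primrec blank_repeats :: "nat \<Rightarrow> nat list \<Rightarrow> nat list" where
  "blank_repeats m [] = []"
| "blank_repeats m (x # xs) = (if x = m then 0 else x) # blank_repeats x xs"

lemma length_running_max [simp]: "length (running_max m xs) = length xs"
  by (induction xs arbitrary: m) auto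

lemma length_blank_repeats [simp]: "length (blank_repeats m xs) = length xs"
  by (induction xs arbitrary: m) auto

lemma sorted_running_max: "sorted (running_max m xs) \<and> (\<forall>x\<in>set (running_max m xs). m \<le> x)"
  by (induction xs arbitrary: m) fastforce+

lemma set_running_max_subset: "set (running_max m xs) \<subseteq> insert m (set xs)"
  by (induction xs arbitrary: m) (fastforce simp: max_def)+

lemma set_blank_repeats_subset: "set (blank_repeats m xs) \<subseteq> insert 0 (set xs)"
  by (induction xs arbitrary: m) fastforce+

lemma running_max_nth_le:
  assumes "\<And>i. i < length xs \<Longrightarrow> xs ! i \<le> i + c" "m \<le> c" "i < length xs"
  shows "running_max m xs ! i \<le> i + c"
  using assms
proof (induction xs arbitrary: m c i)
  case (Cons x xs)
  have "x \<le> c" using Cons.prems(1)[of 0] by simp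
  show ?case
  proof (cases i)
    case (Suc i')
    have "running_max (max m x) xs ! i' \<le> i' + Suc c"
      using Cons.prems Cons.prems(1)[of "Suc _"] \<open>x \<le> c\<close> Suc by (intro Cons.IH) auto
    with Suc show ?thesis by simp
  qed (use \<open>x \<le> c\<close> Cons.prems in auto)
qed simp

lemma blank_repeats_nth_le: "i < length xs \<Longrightarrow> blank_repeats m xs ! i \<le> xs ! i"
  by (induction xs arbitrary: m i) (auto simp: nth_Cons split: nat.split)

lemma strict_blank_repeats:
  assumes "sorted (m # xs)"
  shows "sorted_wrt (\<lambda>x y. x < y \<or> y = 0) (blank_repeats m xs) \<and>
    (\<forall>y\<in>set (blank_repeats m xs). m < y \<or> y = 0)"
  using assms
proof (induction xs arbitrary: m)
  case (Cons x xs)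
  then have "sorted (x # xs)" "m \<le> x" by auto
  with Cons.IH[of x] show ?case by fastforce
qed simp

lemma running_max_blank_repeats: "sorted (m # xs) \<Longrightarrow> running_max m (blank_repeats m xs) = xs"
  by (induction xs arbitrary: m) (auto simp: max_def)

lemma blank_repeats_running_max:
  "sorted_wrt (\<lambda>x y. x < y \<or> y = 0) (m # xs) \<Longrightarrow> blank_repeats m (running_max m xs) = xs"
proof (induction xs arbitrary: m)
  case (Cons x xs)
  then have "sorted_wrt (\<lambda>x y. x < y \<or> y = 0) (max m x # xs)"
    by (auto simp: max_def)
  with Cons.IH[of "max m x"] Cons.prems show ?case
    by (auto simp: max_def)
qed simp

lemma inversion_sequence_append_iff:
  "inversion_sequence (p @ 0 # s) \<longleftrightarrow>
     (\<forall>i<length p. p ! i \<le> i) \<and> (\<forall>i<length s. s ! i \<le> Suc (length p) + i)"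
proof
  assume inv: "inversion_sequence (p @ 0 # s)"
  have "p ! i \<le> i" if "i < length p" for i
    using inv that unfolding inversion_sequence_def by (auto simp: nth_append dest: spec[of _ i])
  moreover have "s ! i \<le> Suc (length p) + i" if "i < length s" for i
    using inv that unfolding inversion_sequence_def
    by (auto simp: nth_append dest: spec[of _ "Suc (length p) + i"])
  ultimately show "(\<forall>i<length p. p ! i \<le> i) \<and> (\<forall>i<length s. s ! i \<le> Suc (length p) + i)"
    by blast
next
  assume ps: "(\<forall>i<length p. p ! i \<le> i) \<and> (\<forall>i<length s. s ! i \<le> Suc (length p) + i)"
  show "inversion_sequence (p @ 0 # s)"
    unfolding inversion_sequence_def
  proof (intro allI impI)
    fix i assume i: "i < length (p @ 0 # s)"
    consider "i < length p" | "i = length p" | d where "i = Suc (length p) + d"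
      by (metis add_Suc less_imp_Suc_add linorder_neqE_nat add_Suc_right)
    then show "(p @ 0 # s) ! i \<le> i"
      using ps i by cases (auto simp: nth_append)
  qed
qed

text \<open>
  A nonempty inversion sequence contains a zero, so it can be encoded by the words before and after
  its last zero. Both pattern sets require the word after the last zero to increase weakly and to be bounded below by
  the word before it; they differ only in the condition \<open>R\<close> on the latter.
\<close>

definition last_zero_splits :: "nat \<Rightarrow> (nat \<Rightarrow> nat \<Rightarrow> bool) \<Rightarrow> (nat list \<times> nat list) set" where
  "last_zero_splits n R = {(p, s). length (p @ 0 # s) = n \<and> inversion_sequence (p @ 0 # s) \<and>
     0 \<notin> set s \<and> sorted_wrt R p \<and> sorted s \<and> (\<forall>x\<in>set p. \<forall>y\<in>set s. x \<le> y)}"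

lemma card_inv_seqs_avoiding_last_zero_splits:
  assumes "n \<ge> 1"
    and char: "\<And>p s. inversion_sequence (p @ 0 # s) \<Longrightarrow> 0 \<notin> set s \<Longrightarrow>
      (\<forall>q\<in>Q. avoids (p @ 0 # s) q) \<longleftrightarrow>
      sorted_wrt R p \<and> sorted s \<and> (\<forall>x\<in>set p. \<forall>y\<in>set s. x \<le> y)"
  shows "card (inv_seqs_avoiding n Q) = card (last_zero_splits n R)"
proof -
  let ?join = "\<lambda>(p, s). p @ (0::nat) # s"
  have "inj_on ?join (last_zero_splits n R)"
  proof (rule inj_onI)
    fix a b assume "a \<in> last_zero_splits n R" "b \<in> last_zero_splits n R" "?join a = ?join b"
    then show "a = b"
      by (auto simp: last_zero_splits_def append_eq_append_conv2 append_eq_Cons_conv Cons_eq_append_conv)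
  qed
  moreover have "?join ` last_zero_splits n R = inv_seqs_avoiding n Q"
  proof
    show "?join ` last_zero_splits n R \<subseteq> inv_seqs_avoiding n Q"
    proof clarify
      fix p s assume "(p, s) \<in> last_zero_splits n R"
      then show "p @ 0 # s \<in> inv_seqs_avoiding n Q"
        using char[of p s] unfolding last_zero_splits_def inv_seqs_avoiding_def by blast
    qed
    show "inv_seqs_avoiding n Q \<subseteq> ?join ` last_zero_splits n R"
    proof
      fix e assume e: "e \<in> inv_seqs_avoiding n Q"
      then have "e \<noteq> []" "inversion_sequence e"
        using assms(1) by (auto simp: inv_seqs_avoiding_def)
      then have "0 \<in> set e"
        by (metis inversion_sequence_nth_0 length_greater_0_conv nth_mem)
      then obtain p s where "e = p @ 0 # s" "0 \<notin> set s"
        using split_list_last by metis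
      with e char[of p s] have "(p, s) \<in> last_zero_splits n R"
        by (auto simp: last_zero_splits_def inv_seqs_avoiding_def)
      with \<open>e = p @ 0 # s\<close> show "e \<in> ?join ` last_zero_splits n R" by force
    qed
  qed
  ultimately show ?thesis
    using card_image by metis
qed

text \<open>
  Neither \<open>blank_repeats\<close> nor \<open>running_max\<close> introduces a positive value that was absent before,
  so all entries before the last zero stay bounded by all entries after it.
\<close>

lemma card_last_zero_splits_le_less:
  "card (last_zero_splits n (\<le>)) = card (last_zero_splits n (\<lambda>x y. x < y \<or> y = 0))"
proof -
  have "bij_betw (\<lambda>(p, s). (blank_repeats 0 p, s)) (last_zero_splits n (\<le>))
      (last_zero_splits n (\<lambda>x y. x < y \<or> y = 0))"
  proof (rule bij_betw_byWitness[where f' = "\<lambda>(p, s). (running_max 0 p, s)"])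
    show "\<forall>a\<in>last_zero_splits n (\<le>).
        (\<lambda>(p, s). (running_max 0 p, s)) ((\<lambda>(p, s). (blank_repeats 0 p, s)) a) = a"
      by (auto simp: last_zero_splits_def running_max_blank_repeats)
    show "\<forall>a\<in>last_zero_splits n (\<lambda>x y. x < y \<or> y = 0).
        (\<lambda>(p, s). (blank_repeats 0 p, s)) ((\<lambda>(p, s). (running_max 0 p, s)) a) = a"
      by (auto simp: last_zero_splits_def intro!: blank_repeats_running_max)
    show "(\<lambda>(p, s). (blank_repeats 0 p, s)) ` last_zero_splits n (\<le>)
        \<subseteq> last_zero_splits n (\<lambda>x y. x < y \<or> y = 0)"
    proof clarify
      fix p s assume a: "(p, s) \<in> last_zero_splits n (\<le>)"
      have "blank_repeats 0 p ! i \<le> i" if "i < length p" for i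
        using a that blank_repeats_nth_le[of i p 0] le_trans
        by (fastforce simp: last_zero_splits_def inversion_sequence_append_iff)
      moreover have "sorted_wrt (\<lambda>x y. x < y \<or> y = 0) (blank_repeats 0 p)"
        using a strict_blank_repeats[of 0 p] by (simp add: last_zero_splits_def)
      ultimately show "(blank_repeats 0 p, s) \<in> last_zero_splits n (\<lambda>x y. x < y \<or> y = 0)"
        using a set_blank_repeats_subset[of 0 p]
        by (fastforce simp: last_zero_splits_def inversion_sequence_append_iff)
    qed
    show "(\<lambda>(p, s). (running_max 0 p, s)) ` last_zero_splits n (\<lambda>x y. x < y \<or> y = 0)
        \<subseteq> last_zero_splits n (\<le>)"
    proof clarify
      fix p s assume a: "(p, s) \<in> last_zero_splits n (\<lambda>x y. x < y \<or> y = 0)"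
      have "running_max 0 p ! i \<le> i" if "i < length p" for i
        using a that running_max_nth_le[of p 0 0 i]
        by (simp add: last_zero_splits_def inversion_sequence_append_iff)
      then show "(running_max 0 p, s) \<in> last_zero_splits n (\<le>)"
        using a set_running_max_subset[of 0 p] sorted_running_max[of 0 p]
        by (fastforce simp: last_zero_splits_def inversion_sequence_append_iff)
    qed
  qed
  then show ?thesis by (rule bij_betw_same_card)
qed

theorem theorem8p1:
  shows "wilf_equivalent {[0, 1, 1], [2, 0, 1]} {[0, 1, 1], [2, 1, 0]} \<and>
         wilf_equivalent {[0, 0, 0], [2, 0, 1]} {[0, 0, 0], [2, 1, 0]} \<and>
         wilf_equivalent {[1, 0, 0], [0, 2, 1]} {[1, 1, 0], [0, 2, 1]}"
proof (intro conjI)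
  show "wilf_equivalent {[0, 1, 1], [2, 0, 1]} {[0, 1, 1], [2, 1, 0]}"
    by (rule wilf_equivalent_201_210) (metis avoids_011_iff_count)
  show "wilf_equivalent {[0, 0, 0], [2, 0, 1]} {[0, 0, 0], [2, 1, 0]}"
    by (rule wilf_equivalent_201_210) (metis avoids_000_iff_count)
  show "wilf_equivalent {[1, 0, 0], [0, 2, 1]} {[1, 1, 0], [0, 2, 1]}"
    unfolding wilf_equivalent_def
  proof (intro allI impI)
    fix n :: nat assume "n \<ge> 1"
    have "card (inv_seqs_avoiding n {[1, 0, 0], [0, 2, 1]}) = card (last_zero_splits n (\<le>))"
      using \<open>n \<ge> 1\<close> avoids_100_021_iff by (intro card_inv_seqs_avoiding_last_zero_splits) auto
    also have "\<dots> = card (last_zero_splits n (\<lambda>x y. x < y \<or> y = 0))"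
      by (rule card_last_zero_splits_le_less)
    also have "\<dots> = card (inv_seqs_avoiding n {[1, 1, 0], [0, 2, 1]})"
      using \<open>n \<ge> 1\<close> avoids_110_021_iff
      by (intro card_inv_seqs_avoiding_last_zero_splits[symmetric]) auto
    finally show "card (inv_seqs_avoiding n {[1, 0, 0], [0, 2, 1]}) =
        card (inv_seqs_avoiding n {[1, 1, 0], [0, 2, 1]})" .
  qed
qed

end
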